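(* Let $G=(V,E)$ be a finite, simple, connected, undirected graph with $n\ge 2$ nodes, and let $t$ be an integer with $0\le t<\kappa(G)$. Then no oblivious algorithm solves consensus in $G$ under the $t$-resilient model (i.e. for all input assignments and all failure patterns in $\Phi^{(t)}_{\mathrm{all}}$) in fewer than $\mathrm{radius}(G,t)$ rounds.
   Context: Model. $G=(V,E)$ is a finite simple connected undirected graph whose nodes carry distinct identifiers; $N(v)$ denotes the neighbourhood of $v$ and $\kappa(G)$ the vertex connectivity of $G$ (minimum number of nodes whose removal disconnects $G$ or leaves a single node). Computation proceeds in synchronous rounds $1,2,\dots$: in each round every node sends a message to each neighbour, receives the messages of its neighbours, and computes. Every node knows $G$ and $t$ in advance. Failure patterns. For an integer $t\ge 0$, a failure pattern is a set $\varphi=\{(v,F_v,f_v): v\in F\}$ with $F\subseteq V$, $|F|\le t$, and for each $v\in F$ an integer $f_v\ge 1$ and a nonempty set $F_v\subseteq N(v)$: node $v$ behaves normally in rounds $1,\dots,f_v-1$, in round $f_v$ its messages reach exactly the neighbours in $N(v)\setminus F_v$, and afterwards it sends nothing. Nodes of $F$ are faulty, nodes of $V\setminus F$ are correct in $\varphi$. $\Phi^{(t)}_{\mathrm{all}}$ is the set of all failure patterns with at most $t$ faulty nodes. Causal paths and eccentricity. A causal path w.r.t. $\varphi$ from $v$ to $v'$ is a sequence $u_1=v,u_2,\dots,u_q=v'$ with $u_{i+1}\in N(u_i)$ such that for each $i<q$, $u_i$ has not crashed during rounds $1,\dots,i-1$, and if $u_i$ crashes at round $i$ (i.e. $(u_i,F_{u_i},i)\in\varphi$)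 then $u_{i+1}\notin F_{u_i}$; its length is $q-1$. $\mathrm{ecc}(v,\varphi)$ is the maximum, over all correct nodes $v'$ of $\varphi$, of the minimum length of a causal path w.r.t. $\varphi$ from $v$ to $v'$ (this is $\infty$ if some correct node has no such path). Let $\Phi^\star_v=\{\varphi\in\Phi^{(t)}_{\mathrm{all}}:\mathrm{ecc}(v,\varphi)<\infty\}$ and $\mathrm{radius}(G,t)=\min_{v\in V}\max_{\varphi\in\Phi^\star_v}\mathrm{ecc}(v,\varphi)$. Views and oblivious algorithms. Each node $u$ has an input $x_u$; in the flooding protocol every node sends $(u,x_u)$ in round 1 and in each later round forwards all pairs it knows. $\mathrm{view}(v,r,\varphi)$ is the set of pairs $(u,x_u)$ known to $v$ after $r$ rounds under $\varphi$; $(u,x_u)\in \mathrm{view}(v,r,\varphi)$ iff $u=v$ or there is a causal path w.r.t. $\varphi$ from $u$ to $v$ of length at most $r$. An oblivious algorithm running in $r$ rounds performs this flooding for $r$ rounds, after which each correct node $v$ outputs a value depending only on $v$ and the set $\mathrm{view}(v,r,\varphi)$. Consensus. Inputs are taken from a set $I$ with $|I|\ge2$; every correct node $v$ must output $y_v\in I$ such that all correct nodes output the same value (agreement) and each output equals $x_u$ for some node $u$ (validity). *)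

theory Defs
  imports Main "HOL-Library.Extended_Nat"
begin

text \<open>Graph: vertex set V, edge relation E (symmetric, irreflexive, within V).\<close>

definition simple_graph :: "'v set \<Rightarrow> ('v \<times> 'v) set \<Rightarrow> bool" where
  "simple_graph V E \<longleftrightarrow> finite V \<and> E \<subseteq> V \<times> V \<and> sym E \<and> (\<forall>v. (v, v) \<notin> E)"

definition nbrs :: "('v \<times> 'v) set \<Rightarrow> 'v \<Rightarrow> 'v set" where
  "nbrs E v = {u. (v, u) \<in> E}"

text \<open>The subgraph induced by S is connected.\<close>
definition connected_on :: "('v \<times> 'v) set \<Rightarrow> 'v set \<Rightarrow> bool" where
  "connected_on E S \<longleftrightarrow> (\<forall>u\<in>S. \<forall>w\<in>S. (u, w) \<in> (E \<inter> (S \<times> S))\<^sup>*)"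

text \<open>Vertex connectivity: minimum number of nodes whose removal disconnects G
  or leaves at most a single node.\<close>
definition vertex_connectivity :: "'v set \<Rightarrow> ('v \<times> 'v) set \<Rightarrow> nat" where
  "vertex_connectivity V E =
     Min {card S | S. S \<subseteq> V \<and> (\<not> connected_on E (V - S) \<or> card (V - S) \<le> 1)}"

text \<open>Failure patterns: sets of triples (v, F_v, f_v).\<close>
definition faulty :: "('v \<times> 'v set \<times> nat) set \<Rightarrow> 'v set" where
  "faulty \<phi> = fst ` \<phi>"

definition failure_pattern ::
  "'v set \<Rightarrow> ('v \<times> 'v) set \<Rightarrow> nat \<Rightarrow> ('v \<times> 'v set \<times> nat) set \<Rightarrow> bool" where
  "failure_pattern V E t \<phi> \<longleftrightarrow>
     finite \<phi> \<and> faulty \<phi> \<subseteq> V \<and> card (faulty \<phi>) \<le> t \<and>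
     (\<forall>a\<in>\<phi>. \<forall>b\<in>\<phi>. fst a = fst b \<longrightarrow> a = b) \<and>
     (\<forall>(v, Fv, f)\<in>\<phi>. f \<ge> 1 \<and> Fv \<noteq> {} \<and> Fv \<subseteq> nbrs E v)"

definition Phi_all :: "'v set \<Rightarrow> ('v \<times> 'v) set \<Rightarrow> nat \<Rightarrow> ('v \<times> 'v set \<times> nat) set set" where
  "Phi_all V E t = {\<phi>. failure_pattern V E t \<phi>}"

text \<open>Causal path u_1 ... u_q (list, 0-indexed: position j corresponds to round j+1).\<close>
definition causal_path ::
  "('v \<times> 'v) set \<Rightarrow> ('v \<times> 'v set \<times> nat) set \<Rightarrow> 'v list \<Rightarrow> 'v \<Rightarrow> 'v \<Rightarrow> bool" where
  "causal_path E \<phi> p v v' \<longleftrightarrow>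
     p \<noteq> [] \<and> hd p = v \<and> last p = v' \<and>
     (\<forall>j. Suc j < length p \<longrightarrow>
        (p ! j, p ! Suc j) \<in> E \<and>
        (\<forall>Fu f. (p ! j, Fu, f) \<in> \<phi> \<longrightarrow> \<not> f \<le> j) \<and>
        (\<forall>Fu. (p ! j, Fu, Suc j) \<in> \<phi> \<longrightarrow> p ! Suc j \<notin> Fu))"

definition causal_dist ::
  "('v \<times> 'v) set \<Rightarrow> ('v \<times> 'v set \<times> nat) set \<Rightarrow> 'v \<Rightarrow> 'v \<Rightarrow> enat" where
  "causal_dist E \<phi> v v' = (INF p \<in> {p. causal_path E \<phi> p v v'}. enat (length p - 1))"

definition ecc ::
  "'v set \<Rightarrow> ('v \<times> 'v) set \<Rightarrow> 'v \<Rightarrow> ('v \<times> 'v set \<times> nat) set \<Rightarrow> enat" where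
  "ecc V E v \<phi> = (SUP v' \<in> V - faulty \<phi>. causal_dist E \<phi> v v')"

definition Phi_star ::
  "'v set \<Rightarrow> ('v \<times> 'v) set \<Rightarrow> nat \<Rightarrow> 'v \<Rightarrow> ('v \<times> 'v set \<times> nat) set set" where
  "Phi_star V E t v = {\<phi> \<in> Phi_all V E t. ecc V E v \<phi> < \<infinity>}"

definition radius :: "'v set \<Rightarrow> ('v \<times> 'v) set \<Rightarrow> nat \<Rightarrow> enat" where
  "radius V E t = (INF v \<in> V. SUP \<phi> \<in> Phi_star V E t v. ecc V E v \<phi>)"

text \<open>View of v after r rounds of flooding under \<phi>, with inputs x.\<close>
definition view ::
  "('v \<times> 'v) set \<Rightarrow> ('v \<Rightarrow> 'i) \<Rightarrow> 'v \<Rightarrow> nat \<Rightarrow> ('v \<times> 'v set \<times> nat) set \<Rightarrow> ('v \<times> 'i) set" where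
  "view E x v r \<phi> = {(u, x u) | u. u = v \<or> (\<exists>p. causal_path E \<phi> p u v \<and> length p - 1 \<le> r)}"

text \<open>An oblivious algorithm running in r rounds is given by an output map
  out :: node \<Rightarrow> view \<Rightarrow> value. It solves consensus in the t-resilient model
  if for all input assignments from I and all failure patterns in Phi_all,
  the outputs of correct nodes agree and are valid.\<close>
definition oblivious_solves_consensus ::
  "'v set \<Rightarrow> ('v \<times> 'v) set \<Rightarrow> nat \<Rightarrow> 'i set \<Rightarrow> nat \<Rightarrow> ('v \<Rightarrow> ('v \<times> 'i) set \<Rightarrow> 'i) \<Rightarrow> bool" where
  "oblivious_solves_consensus V E t I r out \<longleftrightarrow>
     (\<forall>x. (\<forall>u\<in>V. x u \<in> I) \<longrightarrow> (\<forall>\<phi>\<in>Phi_all V E t.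
        (\<forall>v\<in>V - faulty \<phi>. \<forall>w\<in>V - faulty \<phi>. out v (view E x v r \<phi>) = out w (view E x w r \<phi>)) \<and>
        (\<forall>v\<in>V - faulty \<phi>. \<exists>u\<in>V. out v (view E x v r \<phi>) = x u)))"

end

theory Submission
  imports Defs
begin

text \<open>
  Suppose an algorithm decides within \<open>r < radius(G,t)\<close> rounds. For a node \<open>v\<close> take a failure pattern
  under which \<open>v\<close> is heard by some correct node eventually, but is unknown to some correct node \<open>z\<close>
  after \<open>r\<close> rounds. Nodes other than \<open>v\<close> do not know \<open>v\<close> in round 1, so postponing their round-1
  crashes to round 2 leaves the flow of \<open>v\<close>'s input unchanged; hence only \<open>v\<close> need crash in round 1.

  Now give back the lost messages one at a time, each from a node \<open>u\<close> that crashes last, say in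
  round \<open>f\<close>, to a neighbour \<open>w\<close>. From round \<open>f + 1\<close> on only correct nodes send, so this is noticed
  only by nodes that \<open>w\<close> reaches through correct nodes within \<open>r - f\<close> rounds. If these are all the
  correct nodes, then \<open>w\<close> itself notices nothing: it hears anyway every \<open>y\<close> that has reached a correct
  node by round \<open>f\<close>, and this applies to every \<open>y\<close> not crashing in round 1 because \<open>y\<close> has a correct
  neighbour, and to \<open>v\<close> because some correct node hears \<open>v\<close>. So in each step some correct node keeps its
  view, and the decision equals the decision in the failure-free pattern. As \<open>z\<close> does not know the
  input of \<open>v\<close>, the failure-free decision does not depend on it, for any \<open>v\<close>; it is thus
  constant, contradicting validity.
\<close>

section \<open>Information flow round by round\<close>

text \<open>Rounds are counted from 0 here: index \<open>j\<close> stands for round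
  \<open>j + 1\<close>, matching the hop at position \<open>j\<close> of a causal path.\<close>

definition delivers :: "('v \<times> 'v set \<times> nat) set \<Rightarrow> nat \<Rightarrow> 'v \<Rightarrow> 'v \<Rightarrow> bool" where
  "delivers \<phi> j a b \<longleftrightarrow>
     (\<forall>F f. (a, F, f) \<in> \<phi> \<longrightarrow> \<not> f \<le> j) \<and> (\<forall>F. (a, F, Suc j) \<in> \<phi> \<longrightarrow> b \<notin> F)"

text \<open>Arrival over exactly \<open>k\<close> hops, with no waiting at a node. It is not
  monotone in \<open>k\<close>, so views quantify over all \<open>k \<le> r\<close>.\<close>

fun reaches :: "('v \<times> 'v) set \<Rightarrow> ('v \<times> 'v set \<times> nat) set \<Rightarrow> 'v \<Rightarrow> nat \<Rightarrow> 'v \<Rightarrow> bool" where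
  "reaches E \<phi> y 0 x \<longleftrightarrow> x = y"
| "reaches E \<phi> y (Suc k) x \<longleftrightarrow> (\<exists>a. reaches E \<phi> y k a \<and> (a, x) \<in> E \<and> delivers \<phi> k a x)"

lemma causal_path_iff_delivers:
  "causal_path E \<phi> p y x \<longleftrightarrow> p \<noteq> [] \<and> hd p = y \<and> last p = x \<and>
     (\<forall>j. Suc j < length p \<longrightarrow> (p ! j, p ! Suc j) \<in> E \<and> delivers \<phi> j (p ! j) (p ! Suc j))"
  unfolding causal_path_def delivers_def by blast

lemma causal_path_snoc:
  assumes "p \<noteq> []"
  shows "causal_path E \<phi> (p @ [x]) y x' \<longleftrightarrow>
     x' = x \<and> causal_path E \<phi> p y (last p) \<and> (last p, x) \<in> E \<and> delivers \<phi> (length p - 1) (last p) x"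
proof -
  obtain n where n: "length p = Suc n"
    using assms by (cases p) auto
  have l: "last p = p ! n"
    using assms n by (simp add: last_conv_nth)
  show ?thesis
    unfolding causal_path_iff_delivers using assms n
    by (auto simp: nth_append l less_Suc_eq)
qed

lemma reaches_iff_causal_path:
  "reaches E \<phi> y k x \<longleftrightarrow> (\<exists>p. causal_path E \<phi> p y x \<and> length p = Suc k)"
proof (induction k arbitrary: x)
  case 0
  show ?case
  proof
    assume "reaches E \<phi> y 0 x"
    then have "causal_path E \<phi> [y] y x"
      by (simp add: causal_path_iff_delivers)
    then show "\<exists>p. causal_path E \<phi> p y x \<and> length p = Suc 0"
      by fastforce
  qed (auto simp: causal_path_iff_delivers length_Suc_conv)
next
  case (Suc k)
  show ?case
  proof
    assume "reaches E \<phi> y (Suc k) x"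
    then obtain a p where p: "causal_path E \<phi> p y a" "length p = Suc k" "(a, x) \<in> E" "delivers \<phi> k a x"
      using Suc.IH by auto
    then have "p \<noteq> []" "last p = a"
      by (auto simp: causal_path_iff_delivers)
    with p have "causal_path E \<phi> (p @ [x]) y x"
      by (simp add: causal_path_snoc)
    with p(2) show "\<exists>p. causal_path E \<phi> p y x \<and> length p = Suc (Suc k)"
      by (intro exI[of _ "p @ [x]"]) simp
  next
    assume "\<exists>p. causal_path E \<phi> p y x \<and> length p = Suc (Suc k)"
    then obtain q where q: "causal_path E \<phi> q y x" "length q = Suc (Suc k)"
      by blast
    define p where "p = butlast q"
    have qp: "q = p @ [last q]" "length p = Suc k" "p \<noteq> []"
      using q(2) unfolding p_def by (auto simp: append_butlast_last_id simp flip: length_greater_0_conv)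
    then have "causal_path E \<phi> p y (last p) \<and> (last p, x) \<in> E \<and> delivers \<phi> k (last p) x"
      using q(1) causal_path_snoc[OF qp(3), of E \<phi> "last q" y x] by auto
    then show "reaches E \<phi> y (Suc k) x"
      using Suc.IH[of "last p"] qp(2) by auto
  qed
qed

lemma causal_path_le_iff_reaches:
  "(\<exists>p. causal_path E \<phi> p y x \<and> length p - 1 \<le> r) \<longleftrightarrow> (\<exists>k\<le>r. reaches E \<phi> y k x)"
proof
  assume "\<exists>p. causal_path E \<phi> p y x \<and> length p - 1 \<le> r"
  then obtain p where p: "causal_path E \<phi> p y x" "length p - 1 \<le> r"
    by blast
  then have "length p = Suc (length p - 1)"
    by (simp add: causal_path_iff_delivers)
  with p show "\<exists>k\<le>r. reaches E \<phi> y k x"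
    unfolding reaches_iff_causal_path by blast
qed (auto simp: reaches_iff_causal_path)

lemma view_reaches:
  "view E x v r \<phi> = {(u, x u) | u. \<exists>k\<le>r. reaches E \<phi> u k v}"
proof -
  have "u = v \<or> (\<exists>k\<le>r. reaches E \<phi> u k v) \<longleftrightarrow> (\<exists>k\<le>r. reaches E \<phi> u k v)" for u
    by (metis le0 reaches.simps(1))
  then show ?thesis
    unfolding view_def causal_path_le_iff_reaches by auto
qed

lemma view_cong_reaches:
  assumes "\<And>u. (\<exists>k\<le>r. reaches E \<phi> u k v) \<longleftrightarrow> (\<exists>k\<le>r. reaches E \<psi> u k v)"
  shows "view E x v r \<phi> = view E x v r \<psi>"
  unfolding view_reaches using assms by auto

lemma view_cong_input:
  assumes "\<not> (\<exists>k\<le>r. reaches E \<phi> u k v)" "\<And>w. w \<noteq> u \<Longrightarrow> x w = x' w"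
  shows "view E x v r \<phi> = view E x' v r \<phi>"
proof -
  have "x w = x' w" if "\<exists>k\<le>r. reaches E \<phi> w k v" for w
    using that assms by metis
  then show ?thesis
    unfolding view_reaches by (intro Collect_cong) metis
qed

lemma reaches_mono:
  assumes "reaches E \<phi> y k x" "\<And>j a b. j < k \<Longrightarrow> (a, b) \<in> E \<Longrightarrow> delivers \<phi> j a b \<Longrightarrow> delivers \<psi> j a b"
  shows "reaches E \<psi> y k x"
  using assms by (induction k arbitrary: x) (auto, blast)

lemma reaches_source_in:
  assumes "E \<subseteq> V \<times> V" "reaches E \<phi> y k x" "x \<in> V"
  shows "y \<in> V"
  using assms by (induction k arbitrary: x) auto

lemma correct_delivers: "a \<notin> faulty \<phi> \<Longrightarrow> delivers \<phi> j a b"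
  unfolding delivers_def faulty_def by force

text \<open>Correct nodes lose no message, so a walk among them can extend a causal path at any
  time.\<close>

lemma reaches_relpow:
  assumes "reaches E \<phi> y k a" "(a, b) \<in> (E \<inter> (V - faulty \<phi>) \<times> (V - faulty \<phi>)) ^^ m"
  shows "reaches E \<phi> y (k + m) b"
  using assms(2)
proof (induction m arbitrary: b)
  case 0
  then show ?case using assms(1) by simp
next
  case (Suc m)
  then show ?case
    by (auto intro: correct_delivers)
qed

lemma last_crash_silent:
  assumes "\<And>q F g. (q, F, g) \<in> \<phi> \<Longrightarrow> g \<le> f" "f \<le> j" "delivers \<phi> j a b"
  shows "a \<notin> faulty \<phi>"
  using assms unfolding faulty_def delivers_def by fastforce

text \<open>Traced back from \<open>x\<close>, every sender after round \<open>f\<close> lies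
  outside \<open>B\<close>, so the tail of the path stays in \<open>V - B\<close>. The set
  \<open>B\<close> is independent of the pattern because the faulty nodes of one pattern are used
  with the deliveries of another.\<close>

lemma reaches_after_silence:
  assumes "E \<subseteq> V \<times> V" "\<And>j a b. f \<le> j \<Longrightarrow> (a, b) \<in> E \<Longrightarrow> delivers \<phi> j a b \<Longrightarrow> a \<notin> B"
    and "reaches E \<phi> y (f + m) x" "x \<in> V - B"
  shows "\<exists>a\<in>V - B. reaches E \<phi> y f a \<and> (a, x) \<in> (E \<inter> (V - B) \<times> (V - B)) ^^ m"
  using assms(3,4)
proof (induction m arbitrary: x)
  case 0
  then show ?case by auto
next
  case (Suc m)
  then obtain b where b: "reaches E \<phi> y (f + m) b" "(b, x) \<in> E" "delivers \<phi> (f + m) b x"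
    by auto
  then have "b \<in> V - B"
    using assms(1) assms(2)[of "f + m" b x] by auto
  with Suc.IH[OF b(1) this] b(2) Suc.prems(2) show ?case
    by auto
qed

section \<open>Restoring a single message\<close>

lemma symmetric_relpow: "sym R \<Longrightarrow> (a, b) \<in> R ^^ m \<Longrightarrow> (b, a) \<in> R ^^ m"
proof (induction m arbitrary: b)
  case (Suc m)
  then obtain c where c: "(a, c) \<in> R ^^ m" "(c, b) \<in> R"
    by auto
  with Suc have "(c, a) \<in> R ^^ m" "(b, c) \<in> R"
    by (auto dest: symD)
  then show ?case
    by (rule relpow_Suc_I2[rotated])
qed simp

text \<open>The pattern \<open>\<psi>'\<close> is given only through its deliveries, which covers
  both shrinking a set of lost messages and moving a crash to the next round.\<close>

lemma restore_message_keeps_some_view: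
  assumes E: "E \<subseteq> V \<times> V" "sym E"
    and correct_nbr: "\<And>y. y \<in> V \<Longrightarrow> \<exists>c\<in>V - faulty \<psi>. (y, c) \<in> E"
    and last: "\<And>q F g. (q, F, g) \<in> \<psi> \<Longrightarrow> g \<le> f"
    and pos: "\<And>q F g. (q, F, g) \<in> \<psi> \<Longrightarrow> 1 \<le> g"
    and first: "\<And>q F. (q, F, 1) \<in> \<psi> \<Longrightarrow> q = v"
    and heard: "c\<^sub>0 \<in> V - faulty \<psi>" "reaches E \<psi> v k\<^sub>0 c\<^sub>0"
    and f: "1 \<le> f" "f \<le> r"
    and delivers': "\<And>j a b. (a, b) \<in> E \<Longrightarrow>
      delivers \<psi>' j a b \<longleftrightarrow> delivers \<psi> j a b \<or> (a = u \<and> b = w \<and> Suc j = f)"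
  shows "\<exists>x\<in>V - faulty \<psi>. \<forall>y. (\<exists>k\<le>r. reaches E \<psi>' y k x) \<longleftrightarrow> (\<exists>k\<le>r. reaches E \<psi> y k x)"
proof -
  define C where "C = V - faulty \<psi>"
  define R where "R = E \<inter> C \<times> C"
  have "sym R"
    using E(2) unfolding R_def sym_def by auto
  have mono: "reaches E \<psi>' y k x" if "reaches E \<psi> y k x" for y k x
    using that by (rule reaches_mono) (simp add: delivers')
  have early: "reaches E \<psi> y k x" if "reaches E \<psi>' y k x" "k < f" for y k x
    using that(1) by (rule reaches_mono) (use that(2) delivers' in auto)
  have at_f: "reaches E \<psi> y f x \<or> x = w" if "reaches E \<psi>' y f x" for y x
  proof -
    obtain f' where f': "f = Suc f'"
      using f(1) by (cases f) auto
    show ?thesis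
      using that early[of y f'] delivers' unfolding f' by auto blast
  qed
  have silent: "a \<notin> faulty \<psi>" if "f \<le> j" "(a, b) \<in> E" "delivers \<psi> j a b" for j a b
    using last that(1,3) by (rule last_crash_silent)
  \<comment> \<open>After round \<open>f\<close> the two patterns deliver the same messages, and only correct nodes send.\<close>
  have late: "\<exists>a\<in>C. reaches E \<psi>' y f a \<and> (a, x) \<in> R ^^ m" if "reaches E \<psi>' y (f + m) x" "x \<in> C" for y m x
    unfolding C_def R_def
  proof (rule reaches_after_silence[OF E(1) _ that(1)])
    fix j a b assume j: "f \<le> j" "(a, b) \<in> E" "delivers \<psi>' j a b"
    then have "delivers \<psi> j a b"
      using delivers' by auto
    with j(1,2) show "a \<notin> faulty \<psi>"
      by (rule silent)
  next
    show "x \<in> V - faulty \<psi>"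
      using that(2) by (simp add: C_def)
  qed
  \<comment> \<open>A path that exists only after the restoration is at \<open>w\<close> after
    \<open>f\<close> hops and continues among correct nodes.\<close>
  have new: "reaches E \<psi> y k x \<or> f \<le> k \<and> w \<in> C \<and> (w, x) \<in> R ^^ (k - f)"
    if yx: "reaches E \<psi>' y k x" "x \<in> C" for y k x
  proof (cases "k < f")
    case False
    define m where "m = k - f"
    have k: "k = f + m"
      using False by (simp add: m_def)
    obtain a where a: "a \<in> C" "reaches E \<psi>' y f a" "(a, x) \<in> R ^^ m"
      using late yx unfolding k by blast
    show ?thesis
    proof (cases "reaches E \<psi> y f a")
      case True
      then have "reaches E \<psi> y k x"
        using a(3) unfolding k R_def C_def by (rule reaches_relpow)
      then show ?thesis ..
    next
      case False
      then show ?thesis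
        using at_f[OF a(2)] a k by auto
    qed
  qed (use early yx in auto)
  have unchanged: "\<exists>x\<in>C. \<forall>y. (\<exists>k\<le>r. reaches E \<psi>' y k x) \<longrightarrow> (\<exists>k\<le>r. reaches E \<psi> y k x)"
  \<comment> \<open>Either some correct node is out of range of \<open>w\<close> in the remaining
    \<open>r - f\<close> rounds and keeps its view, or all are in range and \<open>w\<close> itself
    keeps its view.\<close>
  proof (cases "\<exists>x\<in>C. \<not> (w \<in> C \<and> (\<exists>m\<le>r - f. (w, x) \<in> R ^^ m))")
    case True
    then obtain x where x: "x \<in> C" "\<not> (w \<in> C \<and> (\<exists>m\<le>r - f. (w, x) \<in> R ^^ m))"
      by blast
    have "reaches E \<psi> y k x" if "reaches E \<psi>' y k x" "k \<le> r" for y k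
      using new[OF that(1) x(1)] x(2) that(2) diff_le_mono by blast
    with x(1) show ?thesis by blast
  next
    case False
    then have wC: "w \<in> C" and near: "\<And>x. x \<in> C \<Longrightarrow> \<exists>m\<le>r - f. (w, x) \<in> R ^^ m"
      using heard(1) unfolding C_def by auto
    \<comment> \<open>Since \<open>R\<close> is symmetric, a correct node in range of
      \<open>w\<close> can also send to \<open>w\<close> in time:
      \<open>j + m \<le> f + (r - f) = r\<close>.\<close>
    have relay: "\<exists>k\<le>r. reaches E \<psi> y k w" if c: "c \<in> C" "reaches E \<psi> y j c" "j \<le> f" for y j c
    proof -
      obtain m where m: "m \<le> r - f" "(w, c) \<in> R ^^ m"
        using near c(1) by blast
      then have "(c, w) \<in> R ^^ m"
        using symmetric_relpow[OF \<open>sym R\<close>] by blast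
      with c(2) have "reaches E \<psi> y (j + m) w"
        unfolding R_def C_def by (rule reaches_relpow)
      moreover have "j + m \<le> r"
        using m(1) c(3) f(2) by linarith
      ultimately show ?thesis by blast
    qed
    have "\<exists>k\<le>r. reaches E \<psi> y k w" if y: "\<exists>k\<le>r. reaches E \<psi>' y k w" for y
    proof -
      have "y \<in> V"
        using y wC reaches_source_in[OF E(1)] unfolding C_def by blast
      then obtain c where c: "c \<in> C" "(y, c) \<in> E"
        using correct_nbr unfolding C_def by blast
      show ?thesis
      proof (cases "y = v")
        case True
        show ?thesis
        \<comment> \<open>As \<open>v\<close> may crash in round 1, its correct neighbours need not
          hear it. If \<open>c\<^sub>0\<close> hears it only after round \<open>f\<close>, cutting
          that path at round \<open>f\<close> yields a correct node that hears \<open>v\<close> in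
          time.\<close>
        proof (cases "k\<^sub>0 \<le> f")
          case True
          then show ?thesis
            using relay[of c\<^sub>0 y k\<^sub>0] heard unfolding C_def \<open>y = v\<close> by blast
        next
          case False
          then have "reaches E \<psi> v (f + (k\<^sub>0 - f)) c\<^sub>0"
            using heard(2) by simp
          from reaches_after_silence[OF E(1) _ this heard(1)]
          have "\<exists>a\<in>C. reaches E \<psi> y f a \<and> (a, c\<^sub>0) \<in> R ^^ (k\<^sub>0 - f)"
            unfolding R_def C_def \<open>y = v\<close> using silent .
          then obtain a where "a \<in> C" "reaches E \<psi> y f a"
            by blast
          then show ?thesis
            by (rule relay) simp
        qed
      next
        case False
        then have "(y, F, 1) \<notin> \<psi>" "(y, F, 0) \<notin> \<psi>" for F
          using first[of y F] pos[of y F 0] by auto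
        then have "delivers \<psi> 0 y c"
          by (auto simp: delivers_def intro!: gr0I)
        then have "reaches E \<psi> y 1 c"
          using c(2) by auto
        with c(1) show ?thesis
          using f(1) by (rule relay)
      qed
    qed
    with wC show ?thesis by blast
  qed
  then show ?thesis
    using mono unfolding C_def by blast
qed

section \<open>Failure patterns below the vertex connectivity\<close>

lemma below_vertex_connectivity:
  assumes "finite V" "t < vertex_connectivity V E" "S \<subseteq> V" "card S \<le> t"
  shows "connected_on E (V - S)" "2 \<le> card (V - S)"
proof -
  let ?M = "{card S | S. S \<subseteq> V \<and> (\<not> connected_on E (V - S) \<or> card (V - S) \<le> 1)}"
  have "?M \<subseteq> card ` Pow V"
    by auto
  then have "finite ?M"
    using assms(1) by (meson finite_Pow_iff finite_imageI finite_subset)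
  have "card S \<notin> ?M"
  proof
    assume "card S \<in> ?M"
    then have "vertex_connectivity V E \<le> card S"
      unfolding vertex_connectivity_def using \<open>finite ?M\<close> by (rule Min_le[rotated])
    with assms(2,4) show False by simp
  qed
  with assms(3) have "connected_on E (V - S) \<and> \<not> card (V - S) \<le> 1"
    by blast
  then show "connected_on E (V - S)" "2 \<le> card (V - S)"
    by auto
qed

text \<open>Since \<open>y\<close> may lie in \<open>B\<close>, connectivity is applied after
  removing \<open>B - {y}\<close>; the first step of a path from \<open>y\<close> to another
  remaining node leaves \<open>B\<close>.\<close>

lemma exists_neighbour_outside:
  assumes "finite V" "t < vertex_connectivity V E" "B \<subseteq> V" "card B \<le> t" "y \<in> V"
    and "(y, y) \<notin> E"
  shows "\<exists>c\<in>V - B. (y, c) \<in> E"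
proof -
  let ?S = "B - {y}"
  have "finite B"
    using assms(1,3) finite_subset by blast
  then have S: "?S \<subseteq> V" "card ?S \<le> t"
    using assms(3,4) card_Diff1_le[of B y] by auto
  note conn = below_vertex_connectivity[OF assms(1,2) S]
  have "\<not> V - ?S \<subseteq> {y}"
    using conn(2) card_mono[of "{y}" "V - ?S"] by auto
  then obtain w where w: "w \<in> V - ?S" "w \<noteq> y"
    by blast
  then have "(y, w) \<in> (E \<inter> (V - ?S) \<times> (V - ?S))\<^sup>*"
    using conn(1) assms(5) unfolding connected_on_def by blast
  then obtain c where "(y, c) \<in> E" "c \<in> V - ?S"
    using w(2) by (auto elim: converse_rtranclE)
  moreover from this have "c \<noteq> y"
    using assms(6) by blast
  ultimately show ?thesis by auto
qed

section \<open>Modifying failure patterns\<close>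

lemma delivers_insert:
  assumes "u \<notin> faulty \<phi>"
  shows "delivers (insert (u, F, f) \<phi>) j a b \<longleftrightarrow>
    (if a = u then j < f \<and> (Suc j = f \<longrightarrow> b \<notin> F) else delivers \<phi> j a b)"
proof -
  have "(u, G, g) \<notin> \<phi>" for G g
    using assms unfolding faulty_def by force
  then show ?thesis
    unfolding delivers_def by auto
qed

lemma faulty_insert: "faulty (insert (u, F, f) \<phi>) = insert u (faulty \<phi>)"
  unfolding faulty_def by simp

lemma failure_pattern_insert:
  assumes "u \<notin> faulty \<phi>"
  shows "failure_pattern V E t (insert (u, F, f) \<phi>) \<longleftrightarrow>
    finite \<phi> \<and> insert u (faulty \<phi>) \<subseteq> V \<and> card (insert u (faulty \<phi>)) \<le> t \<and>
    (\<forall>a\<in>\<phi>. \<forall>b\<in>\<phi>. fst a = fst b \<longrightarrow> a = b) \<and>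
    (\<forall>(v, Fv, f)\<in>\<phi>. f \<ge> 1 \<and> Fv \<noteq> {} \<and> Fv \<subseteq> nbrs E v) \<and>
    f \<ge> 1 \<and> F \<noteq> {} \<and> F \<subseteq> nbrs E u"
proof -
  have "fst a \<noteq> u" if "a \<in> \<phi>" for a
    using assms that unfolding faulty_def by auto
  then have "(\<forall>a\<in>insert (u, F, f) \<phi>. \<forall>b\<in>insert (u, F, f) \<phi>. fst a = fst b \<longrightarrow> a = b) \<longleftrightarrow>
    (\<forall>a\<in>\<phi>. \<forall>b\<in>\<phi>. fst a = fst b \<longrightarrow> a = b)"
    by auto
  then show ?thesis
    unfolding failure_pattern_def faulty_insert by auto
qed

lemma failure_pattern_split:
  assumes "failure_pattern V E t \<psi>" "(u, F, f) \<in> \<psi>"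
  obtains \<phi> where "\<psi> = insert (u, F, f) \<phi>" "u \<notin> faulty \<phi>"
proof
  show "\<psi> = insert (u, F, f) (\<psi> - {(u, F, f)})"
    using assms(2) by auto
  show "u \<notin> faulty (\<psi> - {(u, F, f)})"
  proof
    assume "u \<in> faulty (\<psi> - {(u, F, f)})"
    then obtain a where "a \<in> \<psi>" "a \<noteq> (u, F, f)" "fst a = u"
      unfolding faulty_def by auto
    then show False
      using assms unfolding failure_pattern_def by (metis fst_conv)
  qed
qed

text \<open>Losing all of \<open>nbrs E q\<close> in round 2 means that \<open>q\<close> completes
  round 1 and is silent from then on. This set is nonempty, as it contains the set lost
  before.\<close>

definition postpone :: "('v \<times> 'v) set \<Rightarrow> 'v \<Rightarrow> ('v \<times> 'v set \<times> nat) set \<Rightarrow> ('v \<times> 'v set \<times> nat) set" where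
  "postpone E v \<phi> = (\<lambda>(q, F, g). if g = 1 \<and> q \<noteq> v then (q, nbrs E q, 2) else (q, F, g)) ` \<phi>"

lemma mem_postpone:
  "(a, F, g) \<in> postpone E v \<phi> \<longleftrightarrow> (a, F, g) \<in> \<phi> \<and> (g \<noteq> 1 \<or> a = v) \<or>
     F = nbrs E a \<and> g = 2 \<and> a \<noteq> v \<and> (\<exists>F'. (a, F', 1) \<in> \<phi>)"
  unfolding postpone_def image_iff by (force split: if_splits)

lemma faulty_postpone: "faulty (postpone E v \<phi>) = faulty \<phi>"
  unfolding faulty_def postpone_def image_image by (rule image_cong) auto

lemma delivers_postpone:
  assumes "(a, b) \<in> E" "k = 0 \<Longrightarrow> a = v"
  shows "delivers (postpone E v \<phi>) k a b \<longleftrightarrow> delivers \<phi> k a b"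
proof (cases "a \<noteq> v \<and> (\<exists>F'. (a, F', 1) \<in> \<phi>)")
  case True
  then have "1 \<le> k"
    using assms(2) by (cases k) auto
  with True have "\<not> delivers \<phi> k a b"
    unfolding delivers_def by blast
  moreover have "(a, nbrs E a, 2) \<in> postpone E v \<phi>"
    using True by (simp add: mem_postpone)
  then have "\<not> delivers (postpone E v \<phi>) k a b"
    using \<open>1 \<le> k\<close> assms(1) unfolding delivers_def nbrs_def numeral_2_eq_2
    by (metis One_nat_def Suc_leI le_neq_implies_less mem_Collect_eq)
  ultimately show ?thesis by blast
next
  case False
  then have "(a, F, g) \<in> postpone E v \<phi> \<longleftrightarrow> (a, F, g) \<in> \<phi>" for F g
    by (auto simp: mem_postpone)
  then show ?thesis
    unfolding delivers_def by simp
qed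

text \<open>In round 1 only \<open>v\<close> has its input to send, and the crash of
  \<open>v\<close> is unchanged; from round 2 on both patterns deliver the same messages.\<close>

lemma reaches_postpone: "reaches E (postpone E v \<phi>) v k x \<longleftrightarrow> reaches E \<phi> v k x"
proof (induction k arbitrary: x)
  case (Suc k)
  have "delivers (postpone E v \<phi>) k a x \<longleftrightarrow> delivers \<phi> k a x" if "reaches E \<phi> v k a" "(a, x) \<in> E" for a
    using that by (intro delivers_postpone) auto
  then show ?case
    using Suc.IH by auto
qed simp

lemma failure_pattern_postpone:
  assumes "failure_pattern V E t \<phi>"
  shows "failure_pattern V E t (postpone E v \<phi>)"
proof -
  have eq: "a = b" if "a \<in> \<phi>" "b \<in> \<phi>" "fst a = fst b" for a b
    using assms that unfolding failure_pattern_def by blast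
  have "a = b" if ab: "a \<in> postpone E v \<phi>" "b \<in> postpone E v \<phi>" "fst a = fst b" for a b
  proof -
    let ?h = "\<lambda>(q, F, g). if g = 1 \<and> q \<noteq> v then (q, nbrs E q, 2) else (q, F, g)"
    obtain a' b' where h: "a' \<in> \<phi>" "b' \<in> \<phi>" "a = ?h a'" "b = ?h b'"
      using ab unfolding postpone_def by blast
    then have "fst a' = fst b'"
      using ab(3) by (auto split: prod.splits if_splits)
    with eq h show ?thesis by blast
  qed
  moreover have "1 \<le> g \<and> F \<noteq> {} \<and> F \<subseteq> nbrs E q" if "(q, F, g) \<in> postpone E v \<phi>" for q F g
  proof -
    have "1 \<le> g' \<and> F' \<noteq> {} \<and> F' \<subseteq> nbrs E q" if "(q, F', g') \<in> \<phi>" for F' g'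
      using assms that unfolding failure_pattern_def by blast
    with that show ?thesis
      unfolding mem_postpone by fastforce
  qed
  moreover have "finite (postpone E v \<phi>)"
    using assms unfolding postpone_def failure_pattern_def by blast
  ultimately show ?thesis
    using assms unfolding failure_pattern_def faulty_postpone by blast
qed

section \<open>Reduction to the failure-free execution\<close>

text \<open>Each modification leaves the view of some correct node intact, and agreement carries the
  decision from that node to all correct ones.\<close>

lemma decision_eq_failure_free:
  assumes G: "simple_graph V E" "t < vertex_connectivity V E"
    and solves: "oblivious_solves_consensus V E t I r out"
    and x: "\<forall>u\<in>V. x u \<in> I"
    and "failure_pattern V E t \<psi>"
    and "\<And>q F. (q, F, 1) \<in> \<psi> \<Longrightarrow> q = v"
    and "c\<^sub>0 \<in> V - faulty \<psi>" "reaches E \<psi> v k\<^sub>0 c\<^sub>0"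
    and "a \<in> V - faulty \<psi>" "b \<in> V"
  shows "out a (view E x a r \<psi>) = out b (view E x b r {})"
  using assms(5-9)
\<comment> \<open>Moving a crash to the next round may enlarge the lost set to at most
  \<open>card V\<close>; the weight \<open>Suc (card V)\<close> on the remaining rounds outweighs
  this. A crash after round \<open>r\<close> still counts \<open>card F > 0\<close>, so deleting it
  also decreases the sum.\<close>
proof (induction "\<Sum>(q, F, g)\<in>\<psi>. (Suc r - g) * Suc (card V) + card F" arbitrary: \<psi> a rule: less_induct)
  case less
  let ?\<mu> = "\<lambda>(q, F, g). (Suc r - g) * Suc (card V) + card F"
  have V: "finite V" "E \<subseteq> V \<times> V" "sym E" "\<And>u. (u, u) \<notin> E"
    using G(1) unfolding simple_graph_def by auto
  have nbrs: "finite (nbrs E u)" "card (nbrs E u) \<le> card V" for u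
    using V finite_subset[of "nbrs E u" V] card_mono[of V "nbrs E u"] unfolding nbrs_def by auto
  have agree: "out a (view E x a r \<phi>) = out b (view E x b r \<phi>)"
    if "failure_pattern V E t \<phi>" "a \<in> V - faulty \<phi>" "b \<in> V - faulty \<phi>" for \<phi> a b
    using solves x that unfolding oblivious_solves_consensus_def Phi_all_def by blast
  have fin: "finite \<psi>" and pos: "\<And>q F g. (q, F, g) \<in> \<psi> \<Longrightarrow> 1 \<le> g"
    using less.prems(1) unfolding failure_pattern_def by auto
  consider "\<psi> = {}" | u F f where "(u, F, f) \<in> \<psi>" "r < f"
    | "\<psi> \<noteq> {}" "\<And>q F g. (q, F, g) \<in> \<psi> \<Longrightarrow> g \<le> r"
    by (meson not_le)
  then show ?case
  proof cases
    case 1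
    then show ?thesis
      using agree[OF less.prems(1,5)] assms(10) by (simp add: faulty_def)
  next
    case 2
    obtain \<phi> where \<phi>: "\<psi> = insert (u, F, f) \<phi>" "u \<notin> faulty \<phi>"
      using failure_pattern_split[OF less.prems(1) 2(1)] .
    have notin: "(u, F, f) \<notin> \<phi>"
      using \<phi>(2) unfolding faulty_def by force
    have fp: "finite \<phi>" "F \<noteq> {}" "F \<subseteq> nbrs E u"
      using less.prems(1) unfolding \<phi>(1) failure_pattern_insert[OF \<phi>(2)] by auto
    have "card (faulty \<phi>) \<le> card (insert u (faulty \<phi>))"
      using fp(1) by (simp add: faulty_def card_insert_le)
    then have fp': "failure_pattern V E t \<phi>"
      using less.prems(1) unfolding \<phi>(1) failure_pattern_insert[OF \<phi>(2)]
      by (auto simp: failure_pattern_def)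
    have "card F > 0"
      using fp nbrs finite_subset by (metis card_gt_0_iff)
    then have smaller: "sum ?\<mu> \<phi> < sum ?\<mu> \<psi>"
      using fp(1) notin unfolding \<phi>(1) by simp
    have mono: "delivers \<phi> j p q" if "delivers \<psi> j p q" for j p q
      using that unfolding \<phi>(1) delivers_def by blast
    \<comment> \<open>As \<open>k\<^sub>0\<close> may exceed \<open>r\<close>, this follows from
      having more deliveries, not from equal views.\<close>
    have "reaches E \<phi> v k\<^sub>0 c\<^sub>0"
      using less.prems(4) mono by (rule reaches_mono)
    then have "out a (view E x a r \<phi>) = out b (view E x b r {})"
      using less.prems by (intro less.hyps[OF smaller fp']) (auto simp: \<phi>(1) faulty_insert)
    moreover have "reaches E \<phi> y k a \<longleftrightarrow> reaches E \<psi> y k a" if "k \<le> r" for y k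
    proof
      assume "reaches E \<phi> y k a"
      then show "reaches E \<psi> y k a"
      proof (rule reaches_mono)
        fix j p q assume "j < k" "delivers \<phi> j p q"
        then show "delivers \<psi> j p q"
          unfolding \<phi>(1) delivers_insert[OF \<phi>(2)] using 2(2) that by auto
      qed
    next
      assume "reaches E \<psi> y k a"
      then show "reaches E \<phi> y k a"
        using mono by (rule reaches_mono)
    qed
    then have "view E x a r \<phi> = view E x a r \<psi>"
      by (intro view_cong_reaches) blast
    ultimately show ?thesis by simp
  next
    case 3
    \<comment> \<open>A node that crashes last is chosen, so that only correct nodes send after
      round \<open>f\<close>.\<close>
    have "Max ((snd \<circ> snd) ` \<psi>) \<in> (snd \<circ> snd) ` \<psi>"
      using fin 3(1) by (intro Max_in) auto
    then obtain u F f where u: "(u, F, f) \<in> \<psi>" and "f = Max ((snd \<circ> snd) ` \<psi>)"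
      by auto
    then have last: "g \<le> f" if "(q, G, g) \<in> \<psi>" for q G g
      using that fin by (auto simp: rev_image_eqI intro!: Max_ge)
    obtain \<phi> where \<phi>: "\<psi> = insert (u, F, f) \<phi>" "u \<notin> faulty \<phi>"
      using failure_pattern_split[OF less.prems(1) u] .
    have fp: "finite \<phi>" "F \<noteq> {}" "F \<subseteq> nbrs E u" "1 \<le> f"
      using less.prems(1) unfolding \<phi>(1) failure_pattern_insert[OF \<phi>(2)] by auto
    then obtain w where w: "w \<in> F"
      by blast
    \<comment> \<open>A pattern may not lose an empty set of messages: once the last message of round \<open>f\<close> is
      restored, \<open>u\<close> crashes in round \<open>f + 1\<close> without sending anything.\<close>
    define F' where "F' = (if F = {w} then nbrs E u else F - {w})"
    define f' where "f' = (if F = {w} then Suc f else f)"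
    define \<psi>' where "\<psi>' = insert (u, F', f') \<phi>"
    have F': "F' \<noteq> {}" "F' \<subseteq> nbrs E u"
      using fp w unfolding F'_def by auto
    have fp': "failure_pattern V E t \<psi>'"
      using less.prems(1) F' fp(4)
      unfolding \<phi>(1) \<psi>'_def failure_pattern_insert[OF \<phi>(2)] by (simp add: f'_def)
    have faulty: "faulty \<psi>' = faulty \<psi>"
      by (simp add: \<phi>(1) \<psi>'_def faulty_insert)
    have delivers': "delivers \<psi>' j p q \<longleftrightarrow> delivers \<psi> j p q \<or> (p = u \<and> q = w \<and> Suc j = f)"
      if "(p, q) \<in> E" for j p q
      using that w fp(4) unfolding \<phi>(1) \<psi>'_def delivers_insert[OF \<phi>(2)]
      by (auto simp: F'_def f'_def nbrs_def)
    have "finite F"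
      using fp(3) nbrs(1) finite_subset by blast
    have "f \<le> r"
      using 3(2) u by blast
    have "?\<mu> (u, F', f') < ?\<mu> (u, F, f)"
    proof (cases "F = {w}")
      case True
      have "Suc r - f = Suc (r - f)"
        using \<open>f \<le> r\<close> by simp
      then show ?thesis
        using True nbrs(2)[of u] by (simp add: F'_def f'_def)
    next
      case False
      then show ?thesis
        using w \<open>finite F\<close> card_Diff1_less[of F w] by (simp add: F'_def f'_def)
    qed
    moreover have "(u, F, f) \<notin> \<phi>" "(u, F', f') \<notin> \<phi>"
      using \<phi>(2) unfolding faulty_def by force+
    ultimately have smaller: "sum ?\<mu> \<psi>' < sum ?\<mu> \<psi>"
      using fp(1) unfolding \<phi>(1) \<psi>'_def by simp
    have nbr: "\<exists>c\<in>V - faulty \<psi>. (y, c) \<in> E" if "y \<in> V" for y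
      using exists_neighbour_outside[OF V(1) G(2) _ _ that] less.prems(1) V(4)
      unfolding failure_pattern_def by blast
    have "\<exists>z\<in>V - faulty \<psi>. \<forall>y. (\<exists>k\<le>r. reaches E \<psi>' y k z) \<longleftrightarrow> (\<exists>k\<le>r. reaches E \<psi> y k z)"
      by (rule restore_message_keeps_some_view[where f = f and v = v and u = u and w = w])
        (fact V(2,3) nbr last pos less.prems(2-4) fp(4) \<open>f \<le> r\<close> delivers')+
    then obtain z where z: "z \<in> V - faulty \<psi>"
      "\<And>y. (\<exists>k\<le>r. reaches E \<psi>' y k z) \<longleftrightarrow> (\<exists>k\<le>r. reaches E \<psi> y k z)"
      by blast
    have "reaches E \<psi>' v k\<^sub>0 c\<^sub>0"
      using less.prems(4) by (rule reaches_mono) (simp add: delivers')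
    \<comment> \<open>Crash rounds never decrease, so no new crash in round 1 arises.\<close>
    moreover have "q = v" if "(q, G, 1) \<in> \<psi>'" for q G
    proof -
      have "\<exists>G. (q, G, 1) \<in> \<psi>"
        using that fp(4) unfolding \<psi>'_def \<phi>(1) by (auto simp: f'_def split: if_splits)
      then show ?thesis
        using less.prems(2) by blast
    qed
    ultimately have "out z (view E x z r \<psi>') = out b (view E x b r {})"
      using less.prems(3) z(1) by (intro less.hyps[OF smaller fp']) (auto simp: faulty)
    moreover have "view E x z r \<psi>' = view E x z r \<psi>"
      by (intro view_cong_reaches z(2))
    ultimately show ?thesis
      using agree[OF less.prems(1,5) z(1)] by simp
  qed
qed

section \<open>Late hearing from the radius, and the contradiction\<close>

text \<open>Eccentricity above \<open>r\<close> gives a correct \<open>z\<close> not reached within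
  \<open>r\<close> rounds; its finiteness on \<open>Phi_star\<close> ensures that \<open>z\<close>
  is reached later.\<close>

lemma radius_witness:
  assumes "enat r < radius V E t" "v \<in> V"
  obtains \<phi> z where "failure_pattern V E t \<phi>" "z \<in> V - faulty \<phi>"
    "\<not> (\<exists>k\<le>r. reaches E \<phi> v k z)" "\<exists>k. reaches E \<phi> v k z"
proof -
  have "enat r < (SUP \<phi>\<in>Phi_star V E t v. ecc V E v \<phi>)"
    using assms unfolding radius_def by (meson INF_lower less_le_trans)
  then obtain \<phi> where \<phi>: "\<phi> \<in> Phi_star V E t v" "enat r < ecc V E v \<phi>"
    unfolding less_SUP_iff by blast
  then obtain z where z: "z \<in> V - faulty \<phi>" "enat r < causal_dist E \<phi> v z"
    unfolding ecc_def less_SUP_iff by blast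
  have "causal_dist E \<phi> v z \<le> ecc V E v \<phi>"
    unfolding ecc_def using z(1) by (rule SUP_upper)
  also have "\<dots> < \<infinity>"
    using \<phi>(1) by (simp add: Phi_star_def)
  finally have "\<exists>p. causal_path E \<phi> p v z"
    unfolding causal_dist_def INF_less_iff by blast
  then have ev: "\<exists>k. reaches E \<phi> v k z"
    using causal_path_le_iff_reaches[of E \<phi> v z] by blast
  have "\<not> (\<exists>p. causal_path E \<phi> p v z \<and> length p - 1 \<le> r)"
  proof
    assume "\<exists>p. causal_path E \<phi> p v z \<and> length p - 1 \<le> r"
    then obtain p where p: "causal_path E \<phi> p v z" "length p - 1 \<le> r"
      by blast
    then have "causal_dist E \<phi> v z \<le> enat (length p - 1)"
      unfolding causal_dist_def by (intro INF_lower) simp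
    also have "\<dots> \<le> enat r"
      using p(2) by simp
    finally show False
      using z(2) by simp
  qed
  with that[OF _ z(1) _ ev] \<phi>(1) show thesis
    unfolding causal_path_le_iff_reaches Phi_star_def Phi_all_def by blast
qed

theorem theorem1:
  fixes V :: "'v set" and E :: "('v \<times> 'v) set" and t :: nat and I :: "'i set"
  assumes "simple_graph V E"
    and "connected_on E V"
    and "card V \<ge> 2"
    and "t < vertex_connectivity V E"
    and "\<exists>a\<in>I. \<exists>b\<in>I. a \<noteq> b"
  shows "\<not> (\<exists>r out. oblivious_solves_consensus V E t I r out \<and> enat r < radius V E t)"
proof
  assume "\<exists>r out. oblivious_solves_consensus V E t I r out \<and> enat r < radius V E t"
  then obtain r out where solves: "oblivious_solves_consensus V E t I r out" and r: "enat r < radius V E t"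
    by blast
  have "finite V"
    using assms(1) by (simp add: simple_graph_def)
  obtain o\<^sub>0 where o: "o\<^sub>0 \<in> V"
    using assms(3) by fastforce
  define dec where "dec x = out o\<^sub>0 (view E x o\<^sub>0 r {})" for x
  have dec_indep: "dec x = dec x'"
    if v: "v \<in> V" and x: "\<forall>u\<in>V. x u \<in> I" "\<forall>u\<in>V. x' u \<in> I" and eq: "\<And>u. u \<noteq> v \<Longrightarrow> x u = x' u" for v x x'
  proof -
    obtain \<phi> z k where \<phi>: "failure_pattern V E t \<phi>" "z \<in> V - faulty \<phi>"
      "\<not> (\<exists>k\<le>r. reaches E \<phi> v k z)" "reaches E \<phi> v k z"
      using radius_witness[OF r v] by metis
    let ?\<psi> = "postpone E v \<phi>"
    have z: "z \<in> V - faulty ?\<psi>" "reaches E ?\<psi> v k z" "\<not> (\<exists>k\<le>r. reaches E ?\<psi> v k z)"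
      using \<phi> by (simp_all add: faulty_postpone reaches_postpone)
    have first: "q = v" if "(q, F, 1) \<in> ?\<psi>" for q F
      using that by (simp add: mem_postpone)
    have free: "out z (view E y z r ?\<psi>) = dec y" if "\<forall>u\<in>V. y u \<in> I" for y
      unfolding dec_def
      by (rule decision_eq_failure_free[OF assms(1,4) solves that failure_pattern_postpone[OF \<phi>(1)]
            first z(1,2,1) o])
    \<comment> \<open>The view of \<open>z\<close> omits the input of \<open>v\<close>, so it is the
      same for \<open>x\<close> and \<open>x'\<close>, and its output is the failure-free decision
      for both.\<close>
    show ?thesis
      using free[OF x(1)] free[OF x(2)] view_cong_input[OF z(3) eq] by simp
  qed
  obtain a b where ab: "a \<in> I" "b \<in> I" "a \<noteq> b"
    using assms(5) by blast
  \<comment> \<open>The inputs are switched from \<open>a\<close> to \<open>b\<close> one node at a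
    time; \<open>S = V\<close> then contradicts validity.\<close>
  have "dec (\<lambda>u. if u \<in> S then b else a) = dec (\<lambda>u. a)" if "S \<subseteq> V" for S
    using finite_subset[OF that \<open>finite V\<close>] that
  proof (induction S rule: finite_induct)
    case (insert v S)
    then have "dec (\<lambda>u. if u \<in> insert v S then b else a) = dec (\<lambda>u. if u \<in> S then b else a)"
      using ab by (intro dec_indep[of v]) auto
    then show ?case
      using insert by simp
  qed simp
  moreover have "{} \<in> Phi_all V E t"
    by (simp add: Phi_all_def failure_pattern_def faulty_def)
  then have valid: "\<exists>u\<in>V. dec x = x u" if "\<forall>u\<in>V. x u \<in> I" for x
    using solves that o unfolding oblivious_solves_consensus_def dec_def
    by (metis Diff_empty faulty_def image_empty)
  have "dec (\<lambda>u. if u \<in> V then b else a) = b" "dec (\<lambda>u. a) = a"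
    using valid[of "\<lambda>u. if u \<in> V then b else a"] valid[of "\<lambda>u. a"] ab by auto
  ultimately show False
    using ab(3) by auto
qed

end
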